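(* Let $m\ge0$ and $n\ge0$ be integers. Then, for all complex $x$ with $|x|<\tfrac12$, $$Hl\left(\tfrac12,(2m+1)(m+n+1);\,2(m+n+1),\,2m+1;\,m+1,\,m+1;\,x\right)=\binom{n+m}{n}^{-1}\sum_{j=0}^n\binom{2n+2m-2j}{2m}\binom{n+m-j}{m}^{-1}a_{nj}(1-2x)^{2j-2n-2m-1}$$ and $$Hl\left(\tfrac12,(2m+1)(m+n+1);\,2(m+n+1),\,2m+1;\,m+1,\,m+1;\,x\right)=(1-2x)^{-2n-2m-1}\sum_{j=0}^n4^j\binom{n}{j}\frac{(1/2)_j}{(m+1)_j}(x^2-x)^j.$$
   Context: Heun function: for $a\notin\{0,1\}$, $\gamma\notin\{0,-1,-2,\dots\}$ and $\epsilon$ defined by $\alpha+\beta+1=\gamma+\delta+\epsilon$, $Hl(a,q;\alpha,\beta;\gamma,\delta;x)$ denotes the (local) Heun function, i.e. the solution $u(x)$, analytic near $x=0$ and normalized by $u(0)=1$, of $$u''(x)+\left(\frac{\gamma}{x}+\frac{\delta}{x-1}+\frac{\epsilon}{x-a}\right)u'(x)+\frac{\alpha\beta x-q}{x(x-1)(x-a)}u(x)=0.$$ (For $a=\tfrac12$ its power series at $0$ converges for $|x|<\tfrac12$.) Notation: $(y)_0:=1$, $(y)_k:=y(y+1)\cdots(y+k-1)$ for $k\ge1$; $a_{nj}:=4^{-n}\binom{2j}{j}\binom{2n-2j}{n-j}$ for $0\le j\le n$. *)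

theory Defs
  imports "HOL-Complex_Analysis.Complex_Analysis"
begin

text \<open>
  The parameter epsilon is eliminated by alpha + beta + 1 = gamma + delta + epsilon.
\<close>

definition heun_equation ::
  "complex \<Rightarrow> complex \<Rightarrow> complex \<Rightarrow> complex \<Rightarrow> complex \<Rightarrow> complex \<Rightarrow>
   (complex \<Rightarrow> complex) \<Rightarrow> complex \<Rightarrow> bool"
where
  "heun_equation a q \<alpha> \<beta> \<gamma> \<delta> u x \<longleftrightarrow>
     (let \<epsilon> = \<alpha> + \<beta> + 1 - \<gamma> - \<delta> in
        deriv (deriv u) x
        + (\<gamma> / x + \<delta> / (x - 1) + \<epsilon> / (x - a)) * deriv u x
        + (\<alpha> * \<beta> * x - q) / (x * (x - 1) * (x - a)) * u x = 0)"

text \<open>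
  The equation is required on a punctured neighbourhood of 0 only, because 0 is a
  singular point of its coefficients.
\<close>

definition local_heun_solution ::
  "complex \<Rightarrow> complex \<Rightarrow> complex \<Rightarrow> complex \<Rightarrow> complex \<Rightarrow> complex \<Rightarrow>
   (complex \<Rightarrow> complex) \<Rightarrow> bool"
where
  "local_heun_solution a q \<alpha> \<beta> \<gamma> \<delta> u \<longleftrightarrow>
     u analytic_on {0} \<and> u 0 = 1 \<and>
     (\<forall>\<^sub>F x in at 0. heun_equation a q \<alpha> \<beta> \<gamma> \<delta> u x)"

text \<open>
  Only the germ at 0 of a local solution is determined, so the unique object is its power
  series at 0; Hl is the sum of that series within its disc of convergence.  The definition
  is meaningful for a not in {0, 1} and gamma not in {0, -1, -2, ...}.
\<close>

definition Hl ::
  "complex \<Rightarrow> complex \<Rightarrow> complex \<Rightarrow> complex \<Rightarrow> complex \<Rightarrow> complex \<Rightarrow> complex \<Rightarrow> complex"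
where
  "Hl a q \<alpha> \<beta> \<gamma> \<delta> x =
     eval_fps (THE F. \<exists>u. local_heun_solution a q \<alpha> \<beta> \<gamma> \<delta> u \<and> u has_fps_expansion F) x"

text \<open>The intended range is j \<open>\<le>\<close> n; otherwise the subtraction truncates.\<close>

definition a_coeff :: "nat \<Rightarrow> nat \<Rightarrow> complex" where
  "a_coeff n j =
     of_nat ((2 * j) choose j) * of_nat ((2 * n - 2 * j) choose (n - j)) / 4 ^ n"

end

theory Submission
  imports Defs
begin

text \<open>
  Put y = 1 - 2 x and K = 2 n + 2 m + 1.  For these parameters the numerator
  \<open>\<alpha>\<beta>\<close> x - q is a multiple of x - 1/2, so it cancels the singular factor of the last
  coefficient, and x (x - 1) times the Heun operator maps each power y^e to a combination of
  just y^e and y^(e - 2).  A solution in powers of y thus has a two-term recurrence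
  (\<open>heun_coeff_rec\<close>).  The one that starts at the exponent -K stops after n + 1 terms, because
  the factor belonging to y^e vanishes at e = 2 n - K; it is \<open>heun_sol\<close>.

  The coefficients are the products of Pochhammer symbols in \<open>heun_coeff\<close>.  Writing them
  with binomial coefficients (\<open>heun_coeff_binomial\<close>) gives the first formula.  Since
  y^2 - 1 = 4 (x^2 - x), the second formula is the same polynomial in y^2 expanded about
  y^2 = 1, and the Chu-Vandermonde identity identifies the two expansions
  (\<open>hypergeometric_poly_recentre\<close>).  The second form also shows that the value at x = 0 is 1.

  It remains that an analytic solution is determined by its value at 0 (\<open>Hl_eqI\<close>): the
  coefficient recurrence of the Heun equation at 0 determines each next coefficient unless
  \<open>\<gamma>\<close> is a nonpositive integer.  The solution is holomorphic for norm x < 1/2,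
  hence equal to the sum of its power series there.
\<close>

section \<open>Uniqueness of the local Heun function\<close>

text \<open>The Heun operator multiplied by x (x - 1) (x - a), acting on formal power series.\<close>

definition heun_fps_op ::
  "complex \<Rightarrow> complex \<Rightarrow> complex \<Rightarrow> complex \<Rightarrow> complex \<Rightarrow> complex \<Rightarrow> complex fps \<Rightarrow> complex fps"
where
  "heun_fps_op a q \<alpha> \<beta> \<gamma> \<delta> F =
     fps_X * (fps_X - 1) * (fps_X - fps_const a) * fps_deriv (fps_deriv F)
     + (fps_const \<gamma> * (fps_X - 1) * (fps_X - fps_const a)
        + fps_const \<delta> * fps_X * (fps_X - fps_const a)
        + fps_const (\<alpha> + \<beta> + 1 - \<gamma> - \<delta>) * fps_X * (fps_X - 1)) * fps_deriv F
     + (fps_const (\<alpha> * \<beta>) * fps_X - fps_const q) * F"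

lemma heun_fps_op_diff:
  "heun_fps_op a q \<alpha> \<beta> \<gamma> \<delta> (F - G) = heun_fps_op a q \<alpha> \<beta> \<gamma> \<delta> F - heun_fps_op a q \<alpha> \<beta> \<gamma> \<delta> G"
  by (simp add: heun_fps_op_def algebra_simps)

lemma heun_fps_op_eq_0:
  assumes sol: "local_heun_solution a q \<alpha> \<beta> \<gamma> \<delta> u" and F: "u has_fps_expansion F" and a: "a \<noteq> 0"
  shows "heun_fps_op a q \<alpha> \<beta> \<gamma> \<delta> F = 0"
proof -
  define \<epsilon> where "\<epsilon> = \<alpha> + \<beta> + 1 - \<gamma> - \<delta>"
  let ?L = "\<lambda>z. z * (z - 1) * (z - a) * deriv (deriv u) z
     + (\<gamma> * (z - 1) * (z - a) + \<delta> * z * (z - a) + \<epsilon> * z * (z - 1)) * deriv u z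
     + (\<alpha> * \<beta> * z - q) * u z"
  have "(\<lambda>z. z * ?L z) has_fps_expansion fps_X * heun_fps_op a q \<alpha> \<beta> \<gamma> \<delta> F"
    unfolding heun_fps_op_def \<epsilon>_def by (intro fps_expansion_intros F)
  moreover have "\<forall>\<^sub>F z in nhds 0. z * ?L z = 0"
  proof -
    have "\<forall>\<^sub>F z in at 0. heun_equation a q \<alpha> \<beta> \<gamma> \<delta> u z"
      using sol by (simp add: local_heun_solution_def)
    moreover have "\<forall>\<^sub>F z in at 0. z \<noteq> (0::complex)" "\<forall>\<^sub>F z in at 0. z \<noteq> (1::complex)"
      "\<forall>\<^sub>F z in at 0. z \<noteq> a"
      using a by (auto intro: eventually_neq_at_within)
    ultimately have "\<forall>\<^sub>F z in at 0. z * ?L z = 0"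
    proof eventually_elim
      case (elim z)
      have "?L z = z * (z - 1) * (z - a) * (deriv (deriv u) z
        + (\<gamma> / z + \<delta> / (z - 1) + \<epsilon> / (z - a)) * deriv u z
        + (\<alpha> * \<beta> * z - q) / (z * (z - 1) * (z - a)) * u z)"
        using elim(2-4) by (simp add: divide_simps) (simp add: algebra_simps)
      also have "\<dots> = 0"
        using elim(1) by (simp add: heun_equation_def Let_def \<epsilon>_def)
      finally show ?case by simp
    qed
    \<comment> \<open>The factor z makes the identity hold at the puncture as well.\<close>
    then show ?thesis
      by (simp add: eventually_nhds_conv_at)
  qed
  ultimately have "fps_X * heun_fps_op a q \<alpha> \<beta> \<gamma> \<delta> F = 0"
    using fps_expansion_unique_complex has_fps_expansion_0_iff by blast
  then show ?thesis by simp
qed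

text \<open>
  This is the first step of the Frobenius method: the exponents at 0 are 0 and
  1 - \<open>\<gamma>\<close>, so the factor k + \<open>\<gamma>\<close> of the next coefficient is the only
  possible obstruction to solving the recurrence for nonzero a.
\<close>

lemma heun_fps_op_nth:
  assumes "\<And>j. j \<le> k \<Longrightarrow> fps_nth F j = 0"
  shows "fps_nth (heun_fps_op a q \<alpha> \<beta> \<gamma> \<delta> F) k = a * of_nat (k + 1) * (of_nat k + \<gamma>) * fps_nth F (k + 1)"
proof -
  define \<epsilon> where "\<epsilon> = \<alpha> + \<beta> + 1 - \<gamma> - \<delta>"
  define A where "A = fps_X - fps_const (1 + a)"
  define B where "B = fps_const \<gamma> * (fps_X - fps_const (1 + a)) + fps_const \<delta> * (fps_X - fps_const a)
    + fps_const \<epsilon> * (fps_X - 1)"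
  define C where "C = fps_const (\<alpha> * \<beta>) * fps_X - fps_const q"
  have split: "heun_fps_op a q \<alpha> \<beta> \<gamma> \<delta> F =
     fps_const a * (fps_X * fps_deriv (fps_deriv F)) + fps_const (\<gamma> * a) * fps_deriv F
     + (fps_X ^ 2 * (A * fps_deriv (fps_deriv F)) + fps_X * (B * fps_deriv F) + C * F)"
    unfolding heun_fps_op_def \<epsilon>_def[symmetric] A_def B_def C_def
    by (simp add: algebra_simps power2_eq_square flip: fps_const_add fps_const_mult)
  have "fps_nth (fps_X ^ 2 * (A * fps_deriv (fps_deriv F))) k = 0"
    using assms by (auto simp: fps_X_power_mult_nth fps_mult_nth intro!: sum.neutral)
  moreover have "fps_nth (fps_X * (B * fps_deriv F)) k = 0"
    using assms by (auto simp: fps_mult_nth[of B] intro!: sum.neutral)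
  moreover have "fps_nth (C * F) k = 0"
    using assms by (auto simp: fps_mult_nth intro!: sum.neutral)
  ultimately show ?thesis
    by (cases k) (simp_all add: split algebra_simps)
qed

lemma heun_fps_unique:
  assumes "heun_fps_op a q \<alpha> \<beta> \<gamma> \<delta> F = 0" "heun_fps_op a q \<alpha> \<beta> \<gamma> \<delta> G = 0"
    and "fps_nth F 0 = fps_nth G 0" and "a \<noteq> 0" and "\<And>k. \<gamma> \<noteq> - of_nat k"
  shows "F = G"
proof -
  have op: "heun_fps_op a q \<alpha> \<beta> \<gamma> \<delta> (F - G) = 0"
    using assms by (simp add: heun_fps_op_diff)
  have "fps_nth (F - G) k = 0" for k
  proof (induction k rule: less_induct)
    case (less k)
    show ?case
    proof (cases k)
      case 0
      then show ?thesis using assms by simp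
    next
      case (Suc i)
      have "fps_nth (heun_fps_op a q \<alpha> \<beta> \<gamma> \<delta> (F - G)) i
        = a * of_nat (i + 1) * (of_nat i + \<gamma>) * fps_nth (F - G) (i + 1)"
        by (rule heun_fps_op_nth, rule less.IH) (simp add: Suc)
      then have "a * of_nat (i + 1) * (of_nat i + \<gamma>) * fps_nth (F - G) k = 0"
        by (simp only: op Suc) simp
      moreover have "of_nat i + \<gamma> \<noteq> 0"
        using assms(5)[of i] by (metis add_eq_0_iff)
      moreover have "of_nat (i + 1) \<noteq> (0::complex)"
        using of_nat_eq_0_iff by fastforce
      ultimately show ?thesis using \<open>a \<noteq> 0\<close> by (metis mult_eq_0_iff)
    qed
  qed
  then show ?thesis by (simp add: fps_eq_iff)
qed

lemma Hl_eqI: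
  assumes sol: "local_heun_solution a q \<alpha> \<beta> \<gamma> \<delta> u" and hol: "u holomorphic_on ball 0 r"
    and x: "norm x < r" and a: "a \<noteq> 0" and \<gamma>: "\<And>k. \<gamma> \<noteq> - of_nat k"
  shows "Hl a q \<alpha> \<beta> \<gamma> \<delta> x = u x"
proof -
  have F: "u has_fps_expansion fps_expansion u 0"
    using sol by (simp add: local_heun_solution_def analytic_at_imp_has_fps_expansion_0)
  have nth0: "fps_nth G 0 = 1" if "local_heun_solution a q \<alpha> \<beta> \<gamma> \<delta> v" "v has_fps_expansion G" for v G
    using that has_fps_expansion_imp_0_eq_fps_nth_0 by (force simp: local_heun_solution_def)
  have "(THE F. \<exists>u. local_heun_solution a q \<alpha> \<beta> \<gamma> \<delta> u \<and> u has_fps_expansion F) = fps_expansion u 0"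
  proof (rule the_equality)
    fix G assume "\<exists>v. local_heun_solution a q \<alpha> \<beta> \<gamma> \<delta> v \<and> v has_fps_expansion G"
    then obtain v where v: "local_heun_solution a q \<alpha> \<beta> \<gamma> \<delta> v" "v has_fps_expansion G" by blast
    show "G = fps_expansion u 0"
      by (rule heun_fps_unique[OF heun_fps_op_eq_0[OF v a] heun_fps_op_eq_0[OF sol F a] _ a \<gamma>])
         (simp add: nth0[OF v] nth0[OF sol F])
  qed (use sol F in blast)
  then show ?thesis
    unfolding Hl_def using has_fps_expansion_imp_eval_fps_eq[OF F x hol] by simp
qed

section \<open>Re-expansion of a terminating hypergeometric sum\<close>

lemma alternating_Vandermonde_pochhammer:
  fixes b c :: "'a::field_char_0"
  assumes "\<And>i. i < n \<Longrightarrow> c \<noteq> - of_nat i"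
  shows "(\<Sum>k\<le>n. (-1) ^ k * of_nat (n choose k) * (pochhammer b k / pochhammer c k))
         = pochhammer (c - b) n / pochhammer c n"
proof -
  have "(-1) ^ k * of_nat (n choose k) = (pochhammer (- of_nat n) k / fact k :: 'a)" for k
    by (simp add: binomial_gbinomial gbinomial_pochhammer flip: power_mult_distrib mult.assoc)
  then show ?thesis
    using Vandermonde_pochhammer[of n c b] assms by (simp add: atLeast0AtMost mult.commute)
qed

text \<open>
  This is the passage from powers of s - 1 to powers of s in the polynomial
  \<open>\<^sub>2F\<^sub>1\<close>(-n, b; c; 1 - s).  After (s - 1)^j is expanded, trinomial revision makes each
  coefficient a Chu-Vandermonde sum with n, b, c shifted by i.
\<close>

lemma hypergeometric_poly_recentre:
  fixes b c s :: "'a::field_char_0"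
  assumes c: "\<And>i. i < n \<Longrightarrow> c \<noteq> - of_nat i"
  shows "(\<Sum>j\<le>n. of_nat (n choose j) * (pochhammer b j / pochhammer c j) * (s - 1) ^ j)
       = (\<Sum>i\<le>n. of_nat (n choose i) * pochhammer b i * pochhammer (c - b) (n - i) / pochhammer c n * s ^ i)"
proof -
  let ?r = "\<lambda>j. pochhammer b j / pochhammer c j"
  have binom: "(s - 1) ^ j = (\<Sum>i\<le>n. of_nat (j choose i) * s ^ i * (-1) ^ (j - i))" if "j \<le> n" for j
  proof -
    have "(s - 1) ^ j = (\<Sum>i\<le>j. of_nat (j choose i) * s ^ i * (-1) ^ (j - i))"
      using binomial_ring[of s "-1" j] by simp
    also have "\<dots> = (\<Sum>i\<le>n. of_nat (j choose i) * s ^ i * (-1) ^ (j - i))"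
      using that by (intro sum.mono_neutral_left) auto
    finally show ?thesis .
  qed
  have inner: "(\<Sum>j\<le>n. of_nat (n choose j) * ?r j * (of_nat (j choose i) * (-1) ^ (j - i)))
      = of_nat (n choose i) * pochhammer b i * pochhammer (c - b) (n - i) / pochhammer c n"
    if i: "i \<le> n" for i
  proof -
    have "(\<Sum>j\<le>n. of_nat (n choose j) * ?r j * (of_nat (j choose i) * (-1) ^ (j - i)))
      = (\<Sum>j\<in>{i..n}. of_nat (n choose j) * ?r j * (of_nat (j choose i) * (-1) ^ (j - i)))"
      by (intro sum.mono_neutral_right) (auto simp: not_le)
    also have "\<dots> = (\<Sum>k\<le>n - i. of_nat (n choose (k + i)) * ?r (k + i) * (of_nat ((k + i) choose i) * (-1) ^ k))"
      by (rule sum.reindex_bij_witness[of _ "\<lambda>k. k + i" "\<lambda>j. j - i"]) (use i in auto)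
    also have "\<dots> = (\<Sum>k\<le>n - i. of_nat (n choose i) * ?r i * ((-1) ^ k * of_nat ((n - i) choose k)
         * (pochhammer (b + of_nat i) k / pochhammer (c + of_nat i) k)))"
    proof (rule sum.cong[OF refl])
      fix k assume "k \<in> {..n - i}"
      with i have "(n choose (k + i)) * ((k + i) choose i) = (n choose i) * ((n - i) choose k)"
        using choose_mult[of i "k + i" n] by simp
      then have choose: "of_nat (n choose (k + i)) * of_nat ((k + i) choose i)
          = (of_nat (n choose i) * of_nat ((n - i) choose k) :: 'a)"
        by (metis of_nat_mult)
      have ratio: "?r (k + i) = ?r i * (pochhammer (b + of_nat i) k / pochhammer (c + of_nat i) k)"
        by (simp add: add.commute[of k i] pochhammer_product')
      have "of_nat (n choose (k + i)) * ?r (k + i) * (of_nat ((k + i) choose i) * (-1) ^ k)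
        = (of_nat (n choose (k + i)) * of_nat ((k + i) choose i)) * ?r (k + i) * (-1) ^ k"
        by (simp only: mult_ac)
      then show "of_nat (n choose (k + i)) * ?r (k + i) * (of_nat ((k + i) choose i) * (-1) ^ k)
        = of_nat (n choose i) * ?r i * ((-1) ^ k * of_nat ((n - i) choose k)
         * (pochhammer (b + of_nat i) k / pochhammer (c + of_nat i) k))"
        unfolding choose ratio by (simp only: mult_ac)
    qed
    also have "\<dots> = of_nat (n choose i) * ?r i * (pochhammer (c - b) (n - i) / pochhammer (c + of_nat i) (n - i))"
    proof -
      have "c + of_nat i \<noteq> - of_nat k" if "k < n - i" for k
      proof
        assume "c + of_nat i = - of_nat k"
        then have "c = - of_nat (i + k)"
          by (metis add.assoc eq_neg_iff_add_eq_0 of_nat_add)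
        moreover have "i + k < n" using that by simp
        ultimately show False using c by blast
      qed
      then show ?thesis
        using alternating_Vandermonde_pochhammer[of "n - i" "c + of_nat i" "b + of_nat i"]
        unfolding sum_distrib_left[symmetric] by simp
    qed
    also have "\<dots> = of_nat (n choose i) * pochhammer b i * pochhammer (c - b) (n - i) / pochhammer c n"
      using pochhammer_product[OF i, of c] by simp
    finally show ?thesis .
  qed
  have "(\<Sum>j\<le>n. of_nat (n choose j) * ?r j * (s - 1) ^ j)
      = (\<Sum>j\<le>n. \<Sum>i\<le>n. of_nat (n choose j) * ?r j * (of_nat (j choose i) * (-1) ^ (j - i)) * s ^ i)"
    by (intro sum.cong refl) (simp add: binom sum_distrib_left mult_ac)
  also have "\<dots> = (\<Sum>i\<le>n. (\<Sum>j\<le>n. of_nat (n choose j) * ?r j * (of_nat (j choose i) * (-1) ^ (j - i))) * s ^ i)"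
    by (subst sum.swap) (simp add: sum_distrib_right)
  also have "\<dots> = (\<Sum>i\<le>n. of_nat (n choose i) * pochhammer b i * pochhammer (c - b) (n - i) / pochhammer c n * s ^ i)"
    by (intro sum.cong refl) (simp only: inner atMost_iff)
  finally show ?thesis .
qed

section \<open>Coefficients of the solution\<close>

definition heun_coeff :: "nat \<Rightarrow> nat \<Rightarrow> nat \<Rightarrow> complex" where
  "heun_coeff m n i = of_nat (n choose i) * pochhammer (1 / 2) i
     * pochhammer (of_nat m + 1 / 2) (n - i) / pochhammer (of_nat (m + 1)) n"

text \<open>
  The recurrence reaches i = n because n choose (n + 1) is 0: the coefficients stop by
  themselves, and the telescoping sum in \<open>heun_sol_heun_equation\<close> has no upper boundary term.
\<close>

lemma heun_coeff_rec:
  assumes "i \<le> n"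
  shows "heun_coeff m n i * (2 * of_nat i - 2 * of_nat n) * (2 * of_nat i + 1)
    = heun_coeff m n (Suc i) * (2 * of_nat i + 2 - (2 * of_nat n + 2 * of_nat m + 1)) * (2 * of_nat i + 2)"
proof (cases "i = n")
  case True
  then show ?thesis by (simp add: heun_coeff_def)
next
  case False
  with assms obtain d where d: "n = Suc (i + d)"
    by (metis less_imp_Suc_add le_neq_implies_less)
  have "Suc i * (n choose Suc i) = (n - i) * (n choose i)"
    by (metis binomial_absorb_comp binomial_absorption)
  then have "(of_nat i + 1) * of_nat (n choose Suc i) = (of_nat d + 1) * (of_nat (n choose i) :: complex)"
    using d by (metis (no_types, lifting) add_diff_cancel_left' add_Suc_right of_nat_Suc of_nat_mult add.commute)
  then have binom: "of_nat (n choose Suc i) = (of_nat d + 1) * of_nat (n choose i) / (of_nat i + 1 :: complex)"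
    by (metis nonzero_mult_div_cancel_left of_nat_Suc of_nat_neq_0 add.commute)
  have ne: "of_nat i + 1 \<noteq> (0::complex)"
    by (metis of_nat_Suc of_nat_neq_0 add.commute)
  then have ne2: "2 + of_nat i * 2 \<noteq> (0::complex)"
    by (metis add.commute distrib_right mult_1 mult_eq_0_iff zero_neq_numeral)
  have d': "n - i = Suc d" "n - Suc i = d" using d by auto
  show ?thesis
    unfolding heun_coeff_def binom d' pochhammer_rec'
    using ne ne2 by (simp add: d divide_simps) (simp add: algebra_simps)
qed

lemma central_binomial_pochhammer:
  "of_nat ((2 * i) choose i) = (4 ^ i * pochhammer (1 / 2) i / fact i :: complex)"
proof -
  have "fact (2 * i) = (4 ^ i * pochhammer (1 / 2) i * fact i :: complex)"
    using fact_double[of i, where 'a = complex] by (simp add: power_mult)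
  then show ?thesis by (simp add: binomial_fact field_simps power2_eq_square)
qed

lemma fact_double_quotient_pochhammer:
  "fact (2 * N + 2 * m) * fact m = (fact (2 * m) * fact (N + m) * 4 ^ N * pochhammer (of_nat m + 1 / 2) N :: complex)"
proof (induction N)
  case (Suc N)
  have e: "2 * Suc N + 2 * m = Suc (Suc (2 * N + 2 * m))" by simp
  have "fact (2 * Suc N + 2 * m) * fact m = (2 * of_nat N + 2 * of_nat m + 2) * (2 * of_nat N + 2 * of_nat m + 1)
      * (fact (2 * N + 2 * m) * fact m :: complex)"
    unfolding e fact_Suc by (simp add: algebra_simps)
  also have "\<dots> = fact (2 * m) * fact (Suc N + m) * 4 ^ Suc N * pochhammer (of_nat m + 1 / 2) (Suc N)"
    unfolding Suc pochhammer_rec' add_Suc fact_Suc power_Suc by (simp add: algebra_simps)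
  finally show ?case .
qed simp

lemma binomial_quotient_pochhammer:
  "of_nat ((2 * N + 2 * m) choose (2 * m)) * of_nat ((2 * N) choose N) * inverse (of_nat ((N + m) choose m))
   = (4 ^ N * pochhammer (of_nat m + 1 / 2) N / fact N :: complex)"
  using fact_double_quotient_pochhammer[of N m]
  by (simp add: binomial_fact field_simps)

lemma heun_coeff_binomial:
  assumes i: "i \<le> n"
  shows "inverse (of_nat ((n + m) choose n)) * (of_nat ((2 * n + 2 * m - 2 * i) choose (2 * m))
           * inverse (of_nat ((n + m - i) choose m)) * a_coeff n i) = heun_coeff m n i"
proof -
  define N where "N = n - i"
  have n: "n = i + N" using i by (simp add: N_def)
  have sub: "2 * n + 2 * m - 2 * i = 2 * N + 2 * m" "n + m - i = N + m" "2 * n - 2 * i = 2 * N" "n - i = N"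
    by (auto simp: n)
  have "inverse (of_nat ((n + m) choose n)) = (fact n / pochhammer (of_nat (m + 1)) n :: complex)"
  proof -
    have "pochhammer (of_nat (m + 1)) n * fact m = (fact (n + m) :: complex)"
      using pochhammer_product'[of "1 :: complex" m n] by (simp add: add_ac flip: pochhammer_fact)
    moreover from this have "pochhammer (of_nat (m + 1)) n \<noteq> (0::complex)"
      by (metis fact_nonzero mult_zero_left)
    ultimately show ?thesis by (simp add: binomial_fact field_simps)
  qed
  moreover have "of_nat ((2 * n + 2 * m - 2 * i) choose (2 * m)) * inverse (of_nat ((n + m - i) choose m)) * a_coeff n i
    = (of_nat ((2 * N + 2 * m) choose (2 * m)) * of_nat ((2 * N) choose N) * inverse (of_nat ((N + m) choose m)))
      * of_nat ((2 * i) choose i) / 4 ^ n"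
    unfolding a_coeff_def sub by simp
  moreover have "\<dots> = pochhammer (of_nat m + 1 / 2) N * pochhammer (1 / 2) i / (fact N * fact i)"
    unfolding binomial_quotient_pochhammer unfolding central_binomial_pochhammer by (simp add: n power_add field_simps)
  moreover have "of_nat (n choose i) = (fact n / (fact i * fact N) :: complex)"
    using i by (simp add: binomial_fact N_def)
  ultimately show ?thesis
    by (simp add: heun_coeff_def sub mult_ac)
qed

section \<open>The solution of the Heun equation\<close>

definition heun_sol :: "nat \<Rightarrow> nat \<Rightarrow> complex \<Rightarrow> complex" where
  "heun_sol m n x = (\<Sum>i\<le>n. heun_coeff m n i * (1 - 2 * x) powi (2 * int i - 2 * int n - 2 * int m - 1))"

lemma heun_sol_hypergeometric:
  assumes "x \<noteq> 1 / 2"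
  shows "heun_sol m n x = (1 - 2 * x) powi (- 2 * int n - 2 * int m - 1)
           * (\<Sum>j=0..n. 4 ^ j * of_nat (n choose j)
                * (pochhammer (1 / 2) j / pochhammer (of_nat (m + 1)) j) * (x\<^sup>2 - x) ^ j)"
proof -
  let ?y = "1 - 2 * x"
  have y: "?y \<noteq> 0" using assms by (auto simp: field_simps)
  have "heun_sol m n x = ?y powi (- 2 * int n - 2 * int m - 1) * (\<Sum>i\<le>n. heun_coeff m n i * (?y\<^sup>2) ^ i)"
  proof -
    have powi: "?y powi (2 * int i - 2 * int n - 2 * int m - 1)
        = ?y powi (- 2 * int n - 2 * int m - 1) * (?y\<^sup>2) ^ i" for i
    proof -
      have "(?y\<^sup>2) ^ i = ?y powi (2 * int i)"
        by (metis power_int_of_nat power_mult of_nat_mult of_nat_numeral)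
      moreover have "2 * int i - 2 * int n - 2 * int m - 1 = (- 2 * int n - 2 * int m - 1) + 2 * int i"
        by simp
      ultimately show ?thesis using y by (metis power_int_add)
    qed
    show ?thesis
      unfolding heun_sol_def sum_distrib_left by (intro sum.cong refl) (simp only: powi mult.left_commute)
  qed
  also have "(\<Sum>i\<le>n. heun_coeff m n i * (?y\<^sup>2) ^ i)
    = (\<Sum>j\<le>n. of_nat (n choose j) * (pochhammer (1 / 2) j / pochhammer (of_nat (m + 1)) j) * (?y\<^sup>2 - 1) ^ j)"
  proof -
    have "(of_nat (m + 1) :: complex) \<noteq> - of_nat i" for i
      by (metis add_eq_0_iff2 add_is_0 of_nat_add of_nat_eq_0_iff one_neq_zero)
    moreover have "of_nat (m + 1) - 1 / 2 = (of_nat m + 1 / 2 :: complex)" by simp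
    ultimately show ?thesis
      using hypergeometric_poly_recentre[of n "of_nat (m + 1)" "1 / 2 :: complex" "?y\<^sup>2"]
      by (simp add: heun_coeff_def add.commute)
  qed
  also have "?y\<^sup>2 - 1 = 4 * (x\<^sup>2 - x)" by (simp add: power2_eq_square algebra_simps)
  finally show ?thesis
    unfolding power_mult_distrib atLeast0AtMost by (simp only: mult_ac)
qed

lemma heun_sol_0: "heun_sol m n 0 = 1"
proof -
  have "(\<Sum>j=0..n. 4 ^ j * of_nat (n choose j) * (pochhammer (1 / 2) j / pochhammer (of_nat (m + 1)) j) * 0 ^ j)
    = (\<Sum>j=0..n. if j = 0 then 1 else 0 :: complex)"
    by (intro sum.cong) auto
  then show ?thesis by (simp add: heun_sol_hypergeometric)
qed

lemma sum_powi_has_deriv: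
  fixes c :: "nat \<Rightarrow> complex"
  assumes "x \<noteq> 1 / 2"
  shows "((\<lambda>x. \<Sum>i\<le>n. c i * (1 - 2 * x) powi e i)
    has_field_derivative (\<Sum>i\<le>n. - 2 * of_int (e i) * c i * (1 - 2 * x) powi (e i - 1))) (at x)"
proof (rule DERIV_sum)
  fix i
  have "1 - 2 * x \<noteq> 0"
    using assms by (auto simp: field_simps)
  then show "((\<lambda>x. c i * (1 - 2 * x) powi e i)
    has_field_derivative - 2 * of_int (e i) * c i * (1 - 2 * x) powi (e i - 1)) (at x)"
    by (auto intro!: derivative_eq_intros)
qed

lemma deriv_sum_powi:
  fixes c :: "nat \<Rightarrow> complex"
  assumes "x \<noteq> 1 / 2"
  shows "deriv (\<lambda>x. \<Sum>i\<le>n. c i * (1 - 2 * x) powi e i) x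
    = (\<Sum>i\<le>n. - 2 * of_int (e i) * c i * (1 - 2 * x) powi (e i - 1))"
  by (rule DERIV_imp_deriv) (rule sum_powi_has_deriv[OF assms])

lemma deriv2_sum_powi:
  fixes c :: "nat \<Rightarrow> complex"
  assumes x: "x \<noteq> 1 / 2"
  shows "deriv (deriv (\<lambda>x. \<Sum>i\<le>n. c i * (1 - 2 * x) powi e i)) x
    = (\<Sum>i\<le>n. 4 * of_int (e i) * of_int (e i - 1) * c i * (1 - 2 * x) powi (e i - 2))"
proof -
  have "\<forall>\<^sub>F z in nhds x. z \<in> - {1 / 2}"
    using x by (intro eventually_nhds_in_open) auto
  then have "\<forall>\<^sub>F z in nhds x. deriv (\<lambda>x. \<Sum>i\<le>n. c i * (1 - 2 * x) powi e i) z
      = (\<Sum>i\<le>n. (- 2 * of_int (e i) * c i) * (1 - 2 * z) powi (e i - 1))"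
    by eventually_elim (simp add: deriv_sum_powi)
  then have "deriv (deriv (\<lambda>x. \<Sum>i\<le>n. c i * (1 - 2 * x) powi e i)) x
      = deriv (\<lambda>z. \<Sum>i\<le>n. (- 2 * of_int (e i) * c i) * (1 - 2 * z) powi (e i - 1)) x"
    by (rule deriv_cong_ev) simp
  also have "\<dots> = (\<Sum>i\<le>n. - 2 * of_int (e i - 1) * (- 2 * of_int (e i) * c i) * (1 - 2 * x) powi (e i - 1 - 1))"
    by (rule deriv_sum_powi[OF x])
  also have "\<dots> = (\<Sum>i\<le>n. 4 * of_int (e i) * of_int (e i - 1) * c i * (1 - 2 * x) powi (e i - 2))"
  proof (rule sum.cong[OF refl])
    fix i
    have "e i - 1 - 1 = e i - 2" by simp
    moreover have "- 2 * of_int (e i - 1) * (- 2 * of_int (e i) * c i) = 4 * of_int (e i) * of_int (e i - 1) * c i"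
      by (simp only: mult_minus_left mult_minus_right minus_minus) (simp only: mult_ac, simp)
    ultimately show "- 2 * of_int (e i - 1) * (- 2 * of_int (e i) * c i) * (1 - 2 * x) powi (e i - 1 - 1)
      = 4 * of_int (e i) * of_int (e i - 1) * c i * (1 - 2 * x) powi (e i - 2)"
      by (simp only:)
  qed
  finally show ?thesis .
qed

text \<open>
  Put y = 1 - 2 x and K = 2 n + 2 m + 1.  Multiplied by x (x - 1) = (y^2 - 1) / 4, the Heun
  operator sends y^e to (e + 2 m + 1) (e + K + 1) y^e - e (e + K) y^(e - 2).  On the exponents
  e = 2 i - K, \<open>heun_coeff_rec\<close> turns the resulting sum into a telescoping one.
\<close>

lemma heun_sol_heun_equation:
  assumes x: "x \<noteq> 0" "x \<noteq> 1" "x \<noteq> 1 / 2"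
  shows "heun_equation (1 / 2) (of_nat ((2 * m + 1) * (m + n + 1)))
            (of_nat (2 * (m + n + 1))) (of_nat (2 * m + 1))
            (of_nat (m + 1)) (of_nat (m + 1)) (heun_sol m n) x"
proof -
  define y where "y = 1 - 2 * x"
  define M N :: complex where "M = of_nat m" and "N = of_nat n"
  define e where "e = (\<lambda>i. 2 * int i - 2 * int n - 2 * int m - 1)"
  define E where "E = (\<lambda>i. 2 * of_nat i - 2 * N - 2 * M - 1)"
  define c where "c = heun_coeff m n"
  have y: "y \<noteq> 0" using x(3) by (auto simp: y_def field_simps)
  have E: "of_int (e i) = E i" for i by (simp add: e_def E_def M_def N_def)
  define Y where "Y = (\<lambda>i. y powi (e i - 2))"
  have Y1: "y powi (e i - 1) = y * Y i" for i
    using y power_int_add_1[of y "e i - 2"] by (simp add: Y_def mult.commute)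
  have Y2: "y powi e i = y\<^sup>2 * Y i" for i
    using y Y1[of i] power_int_add_1[of y "e i - 1"] by (simp add: power2_eq_square mult_ac)
  have YS: "Y (Suc i) = y\<^sup>2 * Y i" for i
    unfolding Y2[symmetric] by (simp add: Y_def e_def algebra_simps)
  have sol: "heun_sol m n = (\<lambda>x. \<Sum>i\<le>n. c i * (1 - 2 * x) powi e i)"
    by (simp add: heun_sol_def c_def e_def fun_eq_iff)
  have u0: "heun_sol m n x = (\<Sum>i\<le>n. c i * (y\<^sup>2 * Y i))"
    unfolding sol y_def[symmetric] Y2 by simp
  have u1: "deriv (heun_sol m n) x = (\<Sum>i\<le>n. - 2 * E i * c i * (y * Y i))"
    unfolding sol deriv_sum_powi[OF x(3)] y_def[symmetric] Y1 E by simp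
  have u2: "deriv (deriv (heun_sol m n)) x = (\<Sum>i\<le>n. 4 * E i * (E i - 1) * c i * Y i)"
    unfolding sol deriv2_sum_powi[OF x(3)] y_def[symmetric] by (simp add: E Y_def)
  define P where "P = (M + 1) / x + (M + 1) / (x - 1) + (2 * M + 2 * N + 2) / (x - 1 / 2)"
  define Q where "Q = (2 * (M + N + 1) * (2 * M + 1) * x - (2 * M + 1) * (M + N + 1)) / (x * (x - 1) * (x - 1 / 2))"
  have xy: "x = (1 - y) / 2" by (simp add: y_def)
  have P: "x * (x - 1) * P = - (M + 1) * y - (M + N + 1) * (y\<^sup>2 - 1) / y"
  proof -
    have "x * (x - 1) * P = (M + 1) * (2 * x - 1) + (2 * M + 2 * N + 2) * (x * (x - 1) / (x - 1 / 2))"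
      using x(1,2) unfolding P_def by (simp add: divide_simps) (simp add: algebra_simps)
    also have "x * (x - 1) / (x - 1 / 2) = - (y\<^sup>2 - 1) / (2 * y)"
      using y unfolding xy by (simp add: divide_simps) (simp add: power2_eq_square algebra_simps)
    finally show ?thesis using y by (simp add: xy divide_simps) (simp add: power2_eq_square algebra_simps)
  qed
  have Q: "x * (x - 1) * Q = 2 * (2 * M + 1) * (M + N + 1)"
  proof -
    have "2 * (M + N + 1) * (2 * M + 1) * x - (2 * M + 1) * (M + N + 1)
        = 2 * (2 * M + 1) * (M + N + 1) * (x - 1 / 2)"
      by (simp add: field_simps)
    moreover have "x - 1 / 2 \<noteq> 0" using x(3) by simp
    ultimately show ?thesis using x(1,2) unfolding Q_def by simp
  qed
  define T where "T = (\<lambda>i. c i * E i * (2 * of_nat i) * Y i)"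
  have step: "x * (x - 1) * (4 * E i * (E i - 1) * c i * Y i) + x * (x - 1) * P * (- 2 * E i * c i * (y * Y i))
      + x * (x - 1) * Q * (c i * (y\<^sup>2 * Y i)) = T (Suc i) - T i" if "i \<le> n" for i
  proof -
    have "x * (x - 1) * 4 = y\<^sup>2 - 1" by (simp add: y_def power2_eq_square algebra_simps)
    then have "x * (x - 1) * (4 * E i * (E i - 1) * c i * Y i) = (y\<^sup>2 - 1) * E i * (E i - 1) * c i * Y i"
      by (metis mult.assoc)
    moreover have "x * (x - 1) * P * (- 2 * E i * c i * (y * Y i))
        = 2 * ((M + 1) * y\<^sup>2 + (M + N + 1) * (y\<^sup>2 - 1)) * E i * c i * Y i"
      unfolding P using y by (simp add: divide_simps) (simp add: power2_eq_square algebra_simps)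
    moreover have "(y\<^sup>2 - 1) * E i * (E i - 1) * c i * Y i
        + 2 * ((M + 1) * y\<^sup>2 + (M + N + 1) * (y\<^sup>2 - 1)) * E i * c i * Y i
        + 2 * (2 * M + 1) * (M + N + 1) * (c i * (y\<^sup>2 * Y i))
      = c i * (2 * of_nat i - 2 * N) * (2 * of_nat i + 1) * (y\<^sup>2 * Y i) - T i"
      unfolding T_def E_def by (simp add: power2_eq_square algebra_simps)
    moreover have "c i * (2 * of_nat i - 2 * N) * (2 * of_nat i + 1) * (y\<^sup>2 * Y i) = T (Suc i)"
    proof -
      have "c i * (2 * of_nat i - 2 * N) * (2 * of_nat i + 1)
          = c (Suc i) * E (Suc i) * (2 * of_nat (Suc i))"
        using heun_coeff_rec[OF that, of m] by (simp add: c_def E_def M_def N_def algebra_simps)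
      then show ?thesis by (simp only: T_def YS mult.assoc)
    qed
    ultimately show ?thesis by (simp only: Q)
  qed
  have "x * (x - 1) * (deriv (deriv (heun_sol m n)) x + P * deriv (heun_sol m n) x + Q * heun_sol m n x)
    = (\<Sum>i\<le>n. x * (x - 1) * (4 * E i * (E i - 1) * c i * Y i) + x * (x - 1) * P * (- 2 * E i * c i * (y * Y i))
      + x * (x - 1) * Q * (c i * (y\<^sup>2 * Y i)))"
    unfolding u0 u1 u2 by (simp only: sum.distrib sum_distrib_left distrib_left mult.assoc)
  also have "\<dots> = (\<Sum>i<Suc n. T (Suc i) - T i)"
    unfolding lessThan_Suc_atMost by (intro sum.cong refl step) simp
  also have "\<dots> = 0"
    unfolding sum_lessThan_telescope by (simp add: T_def c_def heun_coeff_def)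
  finally have main: "deriv (deriv (heun_sol m n)) x + P * deriv (heun_sol m n) x + Q * heun_sol m n x = 0"
    using x by simp
  have eps: "of_nat (2 * (m + n + 1)) + of_nat (2 * m + 1) + 1 - of_nat (m + 1) - of_nat (m + 1)
      = 2 * M + 2 * N + 2"
    by (simp add: M_def N_def)
  have params: "of_nat (m + 1) = M + 1" "of_nat (2 * (m + n + 1)) = 2 * (M + N + 1)" "of_nat (2 * m + 1) = 2 * M + 1"
    "of_nat ((2 * m + 1) * (m + n + 1)) = (2 * M + 1) * (M + N + 1)"
    by (simp_all add: M_def N_def algebra_simps)
  show ?thesis
    using main unfolding heun_equation_def Let_def eps unfolding params P_def Q_def .
qed

lemma heun_sol_holomorphic: "heun_sol m n holomorphic_on ball 0 (1 / 2)"
proof -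
  have "1 - 2 * x \<noteq> 0" if "x \<in> ball 0 (1 / 2)" for x :: complex
  proof
    assume "1 - 2 * x = 0"
    then have "x = 1 / 2" by (simp add: field_simps)
    with that show False by simp
  qed
  then show ?thesis
    unfolding heun_sol_def[abs_def] by (intro holomorphic_intros) auto
qed

lemma heun_sol_local_solution:
  "local_heun_solution (1 / 2) (of_nat ((2 * m + 1) * (m + n + 1)))
     (of_nat (2 * (m + n + 1))) (of_nat (2 * m + 1))
     (of_nat (m + 1)) (of_nat (m + 1)) (heun_sol m n)"
  unfolding local_heun_solution_def
proof (intro conjI)
  show "heun_sol m n analytic_on {0}"
    using heun_sol_holomorphic[of m n] by (auto simp: analytic_at intro!: exI[of _ "ball 0 (1 / 2)"])
  have "\<forall>\<^sub>F z in at 0. z \<noteq> (0::complex)" "\<forall>\<^sub>F z in at 0. z \<noteq> (1::complex)" "\<forall>\<^sub>F z in at 0. z \<noteq> (1 / 2 :: complex)"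
    by (rule eventually_neq_at_within)+
  then show "\<forall>\<^sub>F x in at 0. heun_equation (1 / 2) (of_nat ((2 * m + 1) * (m + n + 1)))
     (of_nat (2 * (m + n + 1))) (of_nat (2 * m + 1)) (of_nat (m + 1)) (of_nat (m + 1)) (heun_sol m n) x"
    by eventually_elim (rule heun_sol_heun_equation)
qed (rule heun_sol_0)

theorem theorem2p4:
  fixes m n :: nat and x :: complex
  assumes "norm x < 1 / 2"
  shows "Hl (1 / 2) (of_nat ((2 * m + 1) * (m + n + 1)))
            (of_nat (2 * (m + n + 1))) (of_nat (2 * m + 1))
            (of_nat (m + 1)) (of_nat (m + 1)) x
         = inverse (of_nat ((n + m) choose n))
           * (\<Sum>j=0..n. of_nat ((2 * n + 2 * m - 2 * j) choose (2 * m))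
                * inverse (of_nat ((n + m - j) choose m))
                * a_coeff n j
                * (1 - 2 * x) powi (2 * int j - 2 * int n - 2 * int m - 1))
         \<and>
         Hl (1 / 2) (of_nat ((2 * m + 1) * (m + n + 1)))
            (of_nat (2 * (m + n + 1))) (of_nat (2 * m + 1))
            (of_nat (m + 1)) (of_nat (m + 1)) x
         = (1 - 2 * x) powi (- 2 * int n - 2 * int m - 1)
           * (\<Sum>j=0..n. 4 ^ j * of_nat (n choose j)
                * (pochhammer (1 / 2) j / pochhammer (of_nat (m + 1)) j)
                * (x\<^sup>2 - x) ^ j)"
proof -
  have "(of_nat (m + 1) :: complex) \<noteq> - of_nat k" for k
    by (metis add_eq_0_iff2 add_is_0 of_nat_add of_nat_eq_0_iff one_neq_zero)
  then have Hl: "Hl (1 / 2) (of_nat ((2 * m + 1) * (m + n + 1)))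
            (of_nat (2 * (m + n + 1))) (of_nat (2 * m + 1))
            (of_nat (m + 1)) (of_nat (m + 1)) x = heun_sol m n x"
    by (intro Hl_eqI[OF heun_sol_local_solution heun_sol_holomorphic assms]) auto
  have "x \<noteq> 1 / 2"
  proof
    assume "x = 1 / 2"
    with assms show False by simp
  qed
  note second = heun_sol_hypergeometric[OF this]
  have first: "heun_sol m n x = inverse (of_nat ((n + m) choose n))
           * (\<Sum>j=0..n. of_nat ((2 * n + 2 * m - 2 * j) choose (2 * m))
                * inverse (of_nat ((n + m - j) choose m))
                * a_coeff n j
                * (1 - 2 * x) powi (2 * int j - 2 * int n - 2 * int m - 1))"
    unfolding heun_sol_def sum_distrib_left atLeast0AtMost
  proof (rule sum.cong[OF refl])
    fix i assume "i \<in> {..n}"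
    then have "i \<le> n" by simp
    then show "heun_coeff m n i * (1 - 2 * x) powi (2 * int i - 2 * int n - 2 * int m - 1)
      = inverse (of_nat ((n + m) choose n)) * (of_nat ((2 * n + 2 * m - 2 * i) choose (2 * m))
          * inverse (of_nat ((n + m - i) choose m)) * a_coeff n i
          * (1 - 2 * x) powi (2 * int i - 2 * int n - 2 * int m - 1))"
      by (simp only: heun_coeff_binomial[symmetric] mult.assoc)
  qed
  show ?thesis unfolding Hl using first second by (rule conjI)
qed

end
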